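(* Let $f$ be a complex-valued arithmetic function and assume that there exists $A>0$ such that $$|f(n)| \ll n^{\phi - 1} (\log (en))^{-A} \quad (n \geqslant 1),$$ where $\phi=(1+\sqrt5)/2$ is the golden ratio. Then, for $x \geqslant 2$, $$\sum_{n \leqslant x} f\left(\left\lfloor x/n \right\rfloor\right) = x \sum_{n=1}^{\infty} \frac{f(n)}{n(n+1)} + O\left( x (\log x)^{-A(\phi-1)} \right).$$
   Context: $\lfloor \cdot\rfloor$ denotes the integer part. *)

theory Defs
  imports Complex_Main
begin

definition golden_ratio :: real where
  "golden_ratio = (1 + sqrt 5) / 2"

end

theory Submission
  imports Defs "HOL-Analysis.Analysis"
begin

text \<open>
  The logarithmic factor is at most 1, so \<open>norm (f n) \<le> C * n powr a\<close> with
  \<open>a = golden_ratio - 1 < 1\<close>, and the hyperbola method with cut at \<open>sqrt x\<close> gives the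
  power-saving error term \<open>x powr ((1 + a) / 2)\<close>. The \<open>n\<close> with
  \<open>\<lfloor>x / n\<rfloor> > \<lfloor>sqrt x\<rfloor>\<close> satisfy \<open>n < sqrt x\<close> and are estimated trivially; for
  \<open>d \<le> sqrt x\<close> the value \<open>\<lfloor>x / n\<rfloor> = d\<close> is taken \<open>x / (d (d + 1)) + O(1)\<close> times;
  the tail of the series beyond \<open>sqrt x\<close> is dominated by a telescoping series.
\<close>

section \<open>Tangent-line bounds and telescoping for powers\<close>

text \<open>Concavity in the form of weighted AM-GM for \<open>y\<close> and 1 with weights
  \<open>b\<close> and \<open>1 - b\<close>. Young's inequality wants positive arguments, so
  \<open>y = 0\<close> is treated apart.\<close>

lemma powr_le_tangent_at_one:
  fixes y b :: real
  assumes "y \<ge> 0" "0 < b" "b \<le> 1"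
  shows "y powr b \<le> 1 + b * (y - 1)"
proof (cases "y = 0")
  case False
  with assms have y: "y > 0" by simp
  have "y powr b * 1 powr (1 - b) \<le> b * y + (1 - b) * 1"
    using assms y by (intro Youngs_inequality_0) auto
  then show ?thesis by (simp add: algebra_simps)
qed (use assms in simp)

text \<open>The tangent bound at \<open>1 - 1 / u\<close>, scaled by \<open>u powr b\<close>. It
  replaces comparison with the integral of the decreasing power \<open>b - 1\<close>.\<close>

lemma powr_diff_ge:
  fixes u b :: real
  assumes "u \<ge> 1" "0 < b" "b \<le> 1"
  shows "b * u powr (b - 1) \<le> u powr b - (u - 1) powr b"
proof -
  have u: "u > 0" using assms by simp
  have "u - 1 = u * (1 - 1 / u)"
    using u by (simp add: right_diff_distrib)
  then have "(u - 1) powr b = u powr b * (1 - 1 / u) powr b"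
    using assms by (metis powr_mult)
  also have "\<dots> \<le> u powr b * (1 + b * ((1 - 1 / u) - 1))"
    using assms by (intro mult_left_mono powr_le_tangent_at_one) auto
  also have "\<dots> = u powr b - b * u powr (b - 1)"
    using u by (simp add: powr_diff field_simps)
  finally show ?thesis by simp
qed

text \<open>The tangent bound at \<open>u / (u + 1)\<close>, scaled by \<open>u powr (- b)\<close>.
  With \<open>b = 1 - a\<close> the left side is, up to a constant, the bound for a term of the
  series.\<close>

lemma powr_minus_diff_ge:
  fixes u b :: real
  assumes "u > 0" "0 < b" "b \<le> 1"
  shows "b * (u powr (1 - b) / (u * (u + 1))) \<le> u powr (- b) - (u + 1) powr (- b)"
proof -
  have "(u + 1) powr (- b) = u powr (- b) * (u / (u + 1)) powr b"
    using assms by (simp add: powr_divide powr_minus field_simps)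
  also have "\<dots> \<le> u powr (- b) * (1 + b * (u / (u + 1) - 1))"
    using assms by (intro mult_left_mono powr_le_tangent_at_one) auto
  also have "u / (u + 1) - 1 = - 1 / (u + 1)"
    using assms by (simp add: field_simps)
  also have "u powr (- b) * (1 + b * (- 1 / (u + 1))) = u powr (- b) - b * (u powr (- b) / (u + 1))"
    by (simp add: algebra_simps)
  also have "u powr (- b) / (u + 1) = u powr (1 - b) / (u * (u + 1))"
    using assms by (simp add: powr_diff powr_minus divide_simps)
  finally show ?thesis by simp
qed

lemma sum_powr_minus_le:
  fixes b :: real
  assumes "0 < b" "b \<le> 1"
  shows "(\<Sum>n = 1..N. real n powr (b - 1)) \<le> real N powr b / b"
proof -
  have "b * (\<Sum>n = 1..N. real n powr (b - 1)) \<le> real N powr b"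
  proof (induction N)
    case (Suc N)
    then show ?case
      using powr_diff_ge[of "real (Suc N)" b] assms by (simp add: algebra_simps)
  qed simp
  then show ?thesis using assms by (simp add: field_simps)
qed

section \<open>Convergence and tail of the series\<close>

lemma norm_series_tail_le:
  fixes f :: "nat \<Rightarrow> 'a :: {real_normed_field, banach}"
  assumes f: "\<And>n. n \<ge> 1 \<Longrightarrow> norm (f n) \<le> C * real n powr a"
    and a: "0 \<le> a" "a < 1" and C: "C \<ge> 0"
  shows "summable (\<lambda>k. f (Suc k) / of_nat (Suc k * (Suc k + 1)))" (is "summable ?t")
    and "norm (\<Sum>k. f (Suc (k + N)) / of_nat (Suc (k + N) * (Suc (k + N) + 1)))
           \<le> C / (1 - a) * real (Suc N) powr (a - 1)"
proof -
  \<comment> \<open>The differences of \<open>h\<close> dominate the terms, by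
    \<open>powr_minus_diff_ge\<close> with \<open>b = 1 - a\<close>; since \<open>h\<close> tends to
    0, the majorant of the tail from \<open>N\<close> sums to exactly \<open>h N\<close>.\<close>
  define h where "h = (\<lambda>k. C / (1 - a) * real (Suc k) powr (a - 1))"
  have t_le: "norm (?t k) \<le> h k - h (Suc k)" for k
  proof -
    have "norm (?t k) = norm (f (Suc k)) / (real (Suc k) * (real (Suc k) + 1))"
      by (simp only: norm_divide norm_of_nat) (simp add: algebra_simps)
    also have "\<dots> \<le> C * real (Suc k) powr a / (real (Suc k) * (real (Suc k) + 1))"
      by (intro divide_right_mono f) auto
    also have "\<dots> = C / (1 - a) *
        ((1 - a) * (real (Suc k) powr (1 - (1 - a)) / (real (Suc k) * (real (Suc k) + 1))))"
      using a by simp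
    also have "\<dots> \<le> C / (1 - a) *
        (real (Suc k) powr (- (1 - a)) - (real (Suc k) + 1) powr (- (1 - a)))"
      using a C by (intro mult_left_mono powr_minus_diff_ge) auto
    also have "\<dots> = h k - h (Suc k)"
      by (simp add: h_def algebra_simps)
    finally show ?thesis .
  qed
  have "(\<lambda>k. real (Suc k) powr (a - 1)) \<longlonglongrightarrow> 0"
    using a filterlim_Suc
    by (intro tendsto_neg_powr filterlim_compose[OF filterlim_real_sequentially]) auto
  then have "h \<longlonglongrightarrow> 0"
    unfolding h_def by (rule tendsto_mult_right_zero)
  then have "(\<lambda>k. h (k + N)) \<longlonglongrightarrow> 0" for N
    by (rule LIMSEQ_ignore_initial_segment)
  then have h_sums: "(\<lambda>k. h (k + N) - h (Suc k + N)) sums h N" for N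
    using telescope_sums'[of "\<lambda>k. h (k + N)" 0] by simp
  have "summable (\<lambda>k. h k - h (Suc k))"
    using h_sums[of 0] by (simp add: sums_iff)
  then show "summable ?t"
    using t_le by (rule summable_comparison_test'[where N = 0])
  have "norm (\<Sum>k. ?t (k + N)) \<le> (\<Sum>k. h (k + N) - h (Suc k + N))"
  proof (rule norm_suminf_le)
    show "norm (?t (k + N)) \<le> h (k + N) - h (Suc k + N)" for k
      using t_le[of "k + N"] by (simp only: add_Suc)
    show "summable (\<lambda>k. h (k + N) - h (Suc k + N))"
      using h_sums[of N] by (simp add: sums_iff)
  qed
  also have "\<dots> = h N"
    using h_sums[of N] by (simp add: sums_iff)
  finally show "norm (\<Sum>k. f (Suc (k + N)) / of_nat (Suc (k + N) * (Suc (k + N) + 1)))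
      \<le> C / (1 - a) * real (Suc N) powr (a - 1)"
    by (simp only: h_def)
qed

section \<open>Counting and the hyperbola method\<close>

text \<open>The condition on \<open>n\<close> means \<open>x / (d + 1) < n\<close> and
  \<open>n \<le> x / d\<close>: a half-open interval of length \<open>x / (d * (d + 1))\<close>,
  whose number of integers differs from its length by at most 1.\<close>

lemma card_floor_divide_eq:
  fixes x :: real
  assumes "x \<ge> 0" "d \<ge> 1"
  shows "\<bar>real (card {n \<in> {1..nat \<lfloor>x\<rfloor>}. nat \<lfloor>x / real n\<rfloor> = d}) - x / real (d * (d + 1))\<bar> \<le> 1"
proof -
  let ?lo = "nat \<lfloor>x / real (d + 1)\<rfloor>" and ?hi = "nat \<lfloor>x / real d\<rfloor>"
  have "{n \<in> {1..nat \<lfloor>x\<rfloor>}. nat \<lfloor>x / real n\<rfloor> = d} = {?lo<..?hi}"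
  proof (intro set_eqI iffI)
    fix n assume "n \<in> {n \<in> {1..nat \<lfloor>x\<rfloor>}. nat \<lfloor>x / real n\<rfloor> = d}"
    then have n: "n \<ge> 1" "\<lfloor>x / real n\<rfloor> = int d" using assms by auto
    then have "real d \<le> x / real n" "x / real n < real d + 1" by linarith+
    then have "real n \<le> x / real d" "x / real (d + 1) < real n"
      using n assms by (simp_all add: field_simps)
    then show "n \<in> {?lo<..?hi}"
      using assms by (auto simp: le_nat_floor nat_less_iff floor_less_iff)
  next
    fix n assume "n \<in> {?lo<..?hi}"
    then have n: "?lo < n" "n \<le> ?hi" by auto
    then have "n \<ge> 1" by simp
    have "x / real (d + 1) < real n"
      using n(1) assms by (simp add: nat_less_iff floor_less_iff)
    moreover have "real n \<le> x / real d"
      using n(2) \<open>n \<ge> 1\<close> by linarith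
    ultimately have "real d \<le> x / real n" "x / real n < real d + 1"
      using \<open>n \<ge> 1\<close> assms by (simp_all add: field_simps)
    \<comment> \<open>As \<open>d \<ge> 1\<close>, the interval lies below \<open>x\<close>, so the
      range restriction on \<open>n\<close> costs nothing.\<close>
    moreover have "x / real d \<le> x / 1"
      using assms by (intro divide_left_mono) auto
    with \<open>real n \<le> x / real d\<close> have "real n \<le> x" by simp
    ultimately have "\<lfloor>x / real n\<rfloor> = int d" "n \<le> nat \<lfloor>x\<rfloor>"
      by (auto simp: floor_eq_iff le_nat_floor)
    then show "n \<in> {n \<in> {1..nat \<lfloor>x\<rfloor>}. nat \<lfloor>x / real n\<rfloor> = d}"
      using \<open>n \<ge> 1\<close> by simp
  qed
  moreover have le: "x / real (d + 1) \<le> x / real d"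
    using assms by (intro divide_left_mono) auto
  moreover have "?lo \<le> ?hi" using le by (intro nat_mono floor_mono)
  moreover have "x / real d - x / real (d + 1) = x / real (d * (d + 1))"
    using assms by (simp add: field_simps)
  moreover have "x / real d \<ge> 0" "x / real (d + 1) \<ge> 0" using assms by auto
  ultimately show ?thesis
    by (simp only: card_greaterThanAtMost of_nat_diff) linarith
qed

text \<open>In the constant, the large quotients and the series tail contribute
  \<open>C / (1 - a)\<close> each, the rounding errors in the counts contribute
  \<open>C\<close>.\<close>

lemma norm_sum_floor_divide_le:
  fixes f :: "nat \<Rightarrow> 'a :: {real_normed_field, banach}" and x :: real
  assumes f: "\<And>n. n \<ge> 1 \<Longrightarrow> norm (f n) \<le> C * real n powr a"
    and a: "0 \<le> a" "a < 1" and C: "C \<ge> 0" and x: "x \<ge> 1"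
  shows "norm ((\<Sum>n = 1..nat \<lfloor>x\<rfloor>. f (nat \<lfloor>x / real n\<rfloor>))
             - of_real x * (\<Sum>k. f (Suc k) / of_nat (Suc k * (Suc k + 1))))
         \<le> C * (2 / (1 - a) + 1) * x powr ((1 + a) / 2)"
proof -
  define y where "y = sqrt x"
  have y: "y \<ge> 1" "x = y * y" using x by (auto simp: y_def)
  have y_powr: "x powr ((1 + a) / 2) = y powr (1 + a)"
    using x by (simp add: y_def powr_half_sqrt [symmetric] powr_powr)
  define N where "N = nat \<lfloor>y\<rfloor>"
  have N: "real N \<le> y" "y < real (Suc N)" unfolding N_def using y by linarith+
  define q where "q = (\<lambda>n. nat \<lfloor>x / real n\<rfloor>)"
  define P where "P = {1..nat \<lfloor>x\<rfloor>}"
  define w where "w = (\<lambda>d. real (card {n \<in> P. q n = d}))"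
  define t where "t = (\<lambda>k. f (Suc k) / of_nat (Suc k * (Suc k + 1)))"
  \<comment> \<open>Positivity of \<open>q n\<close> keeps \<open>f\<close> away from 0, where no
    bound is assumed.\<close>
  have q_pos: "q n \<ge> 1" and q_le: "real (q n) \<le> x / real n" if "n \<in> P" for n
  proof -
    have "real n \<le> x" "n \<ge> 1" using that x by (auto simp: P_def le_nat_iff le_floor_iff)
    then have "1 \<le> x / real n" by (simp add: field_simps)
    then show "q n \<ge> 1" "real (q n) \<le> x / real n"
      unfolding q_def by (linarith)+
  qed

  have head: "norm (\<Sum>n\<in>{n\<in>P. q n > N}. f (q n)) \<le> C / (1 - a) * y powr (1 + a)"
  proof -
    have sub: "{n\<in>P. q n > N} \<subseteq> {1..N}"
    proof
      fix n assume n: "n \<in> {n\<in>P. q n > N}"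
      then have "n \<ge> 1" by (simp add: P_def)
      have "y < real (q n)" using N n by (simp add: less_le_trans)
      then have "y < x / real n" using q_le[of n] n by simp
      then have "real n < y" using \<open>n \<ge> 1\<close> y by (simp add: field_simps)
      then show "n \<in> {1..N}" using \<open>n \<ge> 1\<close> by (simp add: N_def le_nat_floor)
    qed
    have "norm (\<Sum>n\<in>{n\<in>P. q n > N}. f (q n)) \<le> (\<Sum>n\<in>{n\<in>P. q n > N}. C * (x / real n) powr a)"
    proof (rule sum_norm_le)
      fix n assume n: "n \<in> {n\<in>P. q n > N}"
      then have "norm (f (q n)) \<le> C * real (q n) powr a" using q_pos by (intro f) auto
      also have "\<dots> \<le> C * (x / real n) powr a"
        using n C a q_le by (intro mult_left_mono powr_mono2) auto
      finally show "norm (f (q n)) \<le> C * (x / real n) powr a" .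
    qed
    also have "\<dots> \<le> (\<Sum>n=1..N. C * (x / real n) powr a)"
      using sub C by (intro sum_mono2) auto
    \<comment> \<open>The exponent \<open>- a\<close> is written as \<open>(1 - a) - 1\<close> to
      match \<open>sum_powr_minus_le\<close> with \<open>b = 1 - a\<close>.\<close>
    also have "\<dots> = C * x powr a * (\<Sum>n=1..N. real n powr ((1 - a) - 1))"
      using x by (simp add: sum_distrib_left powr_divide powr_minus field_simps)
    also have "\<dots> \<le> C * x powr a * (real N powr (1 - a) / (1 - a))"
      using a C by (intro mult_left_mono sum_powr_minus_le) auto
    also have "\<dots> \<le> C * x powr a * (y powr (1 - a) / (1 - a))"
      using a C N by (intro mult_left_mono divide_right_mono powr_mono2) auto
    also have "\<dots> = C / (1 - a) * (y powr a * y powr a * y powr (1 - a))"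
      using y by (simp add: powr_mult)
    also have "y powr a * y powr a * y powr (1 - a) = y powr (1 + a)"
      using y by (simp add: powr_add [symmetric] add.commute)
    finally show ?thesis .
  qed

  \<comment> \<open>At most \<open>y\<close> values of \<open>d\<close> occur, each with counting
    error at most 1 and weight at most \<open>C * y powr a\<close>.\<close>
  have main: "norm (\<Sum>d=1..N. f d * of_real (w d - x / real (d * (d + 1)))) \<le> C * y powr (1 + a)"
  proof -
    have "norm (\<Sum>d=1..N. f d * of_real (w d - x / real (d * (d + 1)))) \<le> (\<Sum>d=1..N. C * y powr a)"
    proof (rule sum_norm_le)
      fix d assume d: "d \<in> {1..N}"
      have "\<bar>w d - x / real (d * (d + 1))\<bar> \<le> 1"
        unfolding w_def P_def q_def using d x by (intro card_floor_divide_eq) auto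
      then have "norm (f d * of_real (w d - x / real (d * (d + 1)))) \<le> norm (f d) * 1"
        unfolding norm_mult norm_of_real by (intro mult_left_mono) auto
      also have "\<dots> \<le> C * real d powr a" using d f by simp
      also have "\<dots> \<le> C * y powr a"
        using d N C a by (intro mult_left_mono powr_mono2) auto
      finally show "norm (f d * of_real (w d - x / real (d * (d + 1)))) \<le> C * y powr a" .
    qed
    also have "\<dots> = real N * (C * y powr a)" by simp
    also have "\<dots> \<le> y * (C * y powr a)" using N C by (intro mult_right_mono) auto
    also have "\<dots> = C * y powr (1 + a)" using y by (simp add: powr_add)
    finally show ?thesis .
  qed

  have tail: "norm (of_real x * (\<Sum>k. t (k + N))) \<le> C / (1 - a) * y powr (1 + a)"
  proof -
    have "norm (of_real x * (\<Sum>k. t (k + N))) \<le> x * (C / (1 - a) * real (Suc N) powr (a - 1))"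
      using x norm_series_tail_le(2)[OF f a C, of N]
      by (simp only: norm_mult norm_of_real t_def) (simp only: abs_of_nonneg mult_left_mono)
    \<comment> \<open>The exponent \<open>a - 1\<close> is negative and \<open>y < Suc N\<close>, so
      passing to \<open>y\<close> increases the power.\<close>
    also have "\<dots> \<le> x * (C / (1 - a) * y powr (a - 1))"
      using x a C N y by (intro mult_left_mono powr_mono2') auto
    also have "\<dots> = C / (1 - a) * (y powr 1 * y powr 1 * y powr (a - 1))"
      using y by simp
    also have "y powr 1 * y powr 1 * y powr (a - 1) = y powr (1 + a)"
      by (simp only: powr_add [symmetric]) simp
    finally show ?thesis .
  qed

  have "(\<Sum>n\<in>P. f (q n)) = (\<Sum>n\<in>{n\<in>P. q n > N}. f (q n)) + (\<Sum>n\<in>{n\<in>P. q n \<le> N}. f (q n))"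
    by (subst sum.union_disjoint [symmetric]) (auto simp: P_def intro!: sum.cong)
  \<comment> \<open>Grouping by the common value \<open>d\<close> of \<open>q n\<close>, which lies
    in \<open>{1..N}\<close> because \<open>q n \<ge> 1\<close>.\<close>
  also have "(\<Sum>n\<in>{n\<in>P. q n \<le> N}. f (q n))
      = (\<Sum>d=1..N. \<Sum>n\<in>{n \<in> {n\<in>P. q n \<le> N}. q n = d}. f (q n))"
    using q_pos by (intro sum.group [symmetric]) (auto simp: P_def)
  also have "\<dots> = (\<Sum>d=1..N. f d * of_real (w d))"
  proof (rule sum.cong)
    fix d assume d: "d \<in> {1..N}"
    then have "{n \<in> {n\<in>P. q n \<le> N}. q n = d} = {n \<in> P. q n = d}" by auto
    then show "(\<Sum>n\<in>{n \<in> {n\<in>P. q n \<le> N}. q n = d}. f (q n)) = f d * of_real (w d)"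
      by (simp add: w_def)
  qed simp
  finally have S: "(\<Sum>n\<in>P. f (q n)) =
    (\<Sum>n\<in>{n\<in>P. q n > N}. f (q n)) + (\<Sum>d=1..N. f d * of_real (w d))" .
  have "summable t" unfolding t_def using norm_series_tail_le(1)[OF f a C] .
  then have "(\<Sum>k. t k) = (\<Sum>k. t (k + N)) + (\<Sum>k<N. t k)"
    by (rule suminf_split_initial_segment)
  also have "(\<Sum>k<N. t k) = (\<Sum>d=1..N. f d / of_nat (d * (d + 1)))"
    unfolding t_def by (rule sum.reindex_bij_witness[of _ "\<lambda>d. d - 1" Suc]) auto
  finally have T: "(\<Sum>k. t k) = (\<Sum>k. t (k + N)) + (\<Sum>d=1..N. f d / of_nat (d * (d + 1)))" .
  \<comment> \<open>The first \<open>N\<close> terms of the series are matched with the counts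
    \<open>w d\<close>, leaving only three error terms.\<close>
  have "(\<Sum>n\<in>P. f (q n)) - of_real x * (\<Sum>k. t k) =
      (\<Sum>n\<in>{n\<in>P. q n > N}. f (q n))
      + (\<Sum>d=1..N. f d * of_real (w d - x / real (d * (d + 1))))
      - of_real x * (\<Sum>k. t (k + N))"
    unfolding S T by (simp add: algebra_simps sum_distrib_left sum_subtractf)
  also have "norm \<dots> \<le> C / (1 - a) * y powr (1 + a) + C * y powr (1 + a) + C / (1 - a) * y powr (1 + a)"
    using head main tail
    by (intro order_trans[OF norm_triangle_ineq4] add_mono order_trans[OF norm_triangle_ineq])
  also have "\<dots> = C * (2 / (1 - a) + 1) * x powr ((1 + a) / 2)"
    unfolding y_powr by (simp add: algebra_simps)
  finally show ?thesis by (simp add: P_def q_def t_def)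
qed

section \<open>From power saving to the logarithmic error term\<close>

text \<open>The bound \<open>ln x \<le> x powr s / s\<close> at \<open>s = e / B\<close>, raised to
  the power \<open>B\<close>.\<close>

lemma ln_powr_le_powr:
  fixes x B e :: real
  assumes "x \<ge> 1" "B > 0" "e > 0"
  shows "ln x powr B \<le> (B / e) powr B * x powr e"
proof -
  have "ln x \<le> x powr (e / B) / (e / B)"
    using assms by (intro ln_powr_bound) auto
  then have "ln x powr B \<le> (x powr (e / B) / (e / B)) powr B"
    using assms by (intro powr_mono2) auto
  also have "\<dots> = ((B / e) * x powr (e / B)) powr B" by (simp add: field_simps)
  also have "\<dots> = (B / e) powr B * x powr e"
    using assms by (subst powr_mult) (auto simp: powr_powr)
  finally show ?thesis .
qed

theorem theorem2p5:
  fixes f :: "nat \<Rightarrow> complex" and A :: real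
  assumes "A > 0"
    and "\<exists>C. \<forall>n\<ge>1. norm (f n)
           \<le> C * (real n powr (golden_ratio - 1) * ln (exp 1 * real n) powr (- A))"
  shows "summable (\<lambda>k. f (Suc k) / of_nat (Suc k * (Suc k + 1))) \<and>
    (\<exists>K. \<forall>x::real. x \<ge> 2 \<longrightarrow>
       norm ((\<Sum>n = 1..nat \<lfloor>x\<rfloor>. f (nat \<lfloor>x / real n\<rfloor>))
             - of_real x * (\<Sum>k. f (Suc k) / of_nat (Suc k * (Suc k + 1))))
         \<le> K * (x * ln x powr (- A * (golden_ratio - 1))))"
proof -
  define a where "a = golden_ratio - 1"
  \<comment> \<open>Here \<open>a = (sqrt 5 - 1) / 2\<close>, so \<open>1 < sqrt 5 < 3\<close> gives
    \<open>0 < a < 1\<close>.\<close>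
  have "sqrt 1 < sqrt 5" "sqrt 5 < sqrt 9" by (simp_all only: real_sqrt_less_iff)
  then have a: "0 < a" "a < 1"
    by (simp_all add: a_def golden_ratio_def real_sqrt_unique[of 3 9])
  obtain C where C: "norm (f n) \<le> C * (real n powr a * ln (exp 1 * real n) powr (- A))"
    if "n \<ge> 1" for n
    using assms(2) unfolding a_def by blast
  \<comment> \<open>At \<open>n = 1\<close> both the power and the logarithmic factor equal 1, which
    forces the sign of \<open>C\<close>.\<close>
  have "0 \<le> norm (f 1)" by simp
  also have "\<dots> \<le> C" using C[of 1] by simp
  finally have "C \<ge> 0" .
  have f: "norm (f n) \<le> C * real n powr a" if "n \<ge> 1" for n
  proof -
    have "ln (exp 1 * real n) \<ge> 1" using that by (simp add: ln_mult)
    then have "ln (exp 1 * real n) powr (- A) \<le> ln (exp 1 * real n) powr 0"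
      using \<open>A > 0\<close> by (intro powr_mono) auto
    then have "ln (exp 1 * real n) powr (- A) \<le> 1"
      using \<open>ln (exp 1 * real n) \<ge> 1\<close> by simp
    then have "C * (real n powr a * ln (exp 1 * real n) powr (- A)) \<le> C * (real n powr a * 1)"
      using \<open>C \<ge> 0\<close> by (intro mult_left_mono) auto
    with C[OF that] show ?thesis by simp
  qed
  \<comment> \<open>\<open>B\<close> is the required logarithmic exponent, \<open>e\<close> the gap
    between 1 and \<open>(1 + a) / 2\<close>, and \<open>D\<close> the constant of the power-saving
    bound.\<close>
  define B e D where "B = A * a" and "e = (1 - a) / 2" and "D = C * (2 / (1 - a) + 1)"
  have "B > 0" "e > 0" "D \<ge> 0" using a \<open>A > 0\<close> \<open>C \<ge> 0\<close> by (auto simp: B_def e_def D_def)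
  have bound: "D * x powr ((1 + a) / 2) \<le> D * (B / e) powr B * (x * ln x powr (- A * a))"
    if "x \<ge> 2" for x :: real
  proof -
    have "ln x > 0" using that by simp
    \<comment> \<open>Inserting \<open>ln x powr B * ln x powr (- B) = 1\<close> lets the first
      factor be absorbed by \<open>x powr e\<close>, which completes the exponent to 1.\<close>
    have "x powr ((1 + a) / 2) = x powr ((1 + a) / 2) * ln x powr B * ln x powr (- B)"
      using \<open>ln x > 0\<close> by (simp add: powr_minus)
    also have "\<dots> \<le> x powr ((1 + a) / 2) * ((B / e) powr B * x powr e) * ln x powr (- B)"
      using that \<open>B > 0\<close> \<open>e > 0\<close> by (intro mult_left_mono mult_right_mono ln_powr_le_powr) auto
    also have "\<dots> = (B / e) powr B * ((x powr ((1 + a) / 2) * x powr e) * ln x powr (- B))"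
      by simp
    also have "x powr ((1 + a) / 2) * x powr e = x"
      using that by (simp add: powr_add [symmetric] e_def add_divide_distrib [symmetric])
    finally have "x powr ((1 + a) / 2) \<le> (B / e) powr B * (x * ln x powr (- A * a))"
      by (simp add: B_def)
    then show ?thesis using \<open>D \<ge> 0\<close> by (simp add: mult.assoc mult_left_mono)
  qed
  have "norm ((\<Sum>n = 1..nat \<lfloor>x\<rfloor>. f (nat \<lfloor>x / real n\<rfloor>))
             - of_real x * (\<Sum>k. f (Suc k) / of_nat (Suc k * (Suc k + 1))))
         \<le> D * (B / e) powr B * (x * ln x powr (- A * a))" if "x \<ge> 2" for x :: real
  proof (rule order_trans[OF _ bound[OF that]])
    show "norm ((\<Sum>n = 1..nat \<lfloor>x\<rfloor>. f (nat \<lfloor>x / real n\<rfloor>))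
             - of_real x * (\<Sum>k. f (Suc k) / of_nat (Suc k * (Suc k + 1))))
         \<le> D * x powr ((1 + a) / 2)"
      unfolding D_def using f a \<open>C \<ge> 0\<close> that by (intro norm_sum_floor_divide_le) simp_all
  qed
  moreover have "summable (\<lambda>k. f (Suc k) / of_nat (Suc k * (Suc k + 1)))"
    using norm_series_tail_le(1)[OF f] a \<open>C \<ge> 0\<close> by simp
  ultimately show ?thesis unfolding a_def by blast
qed

end
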